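(* Let $F:\mathbb{R}^n\to\mathbb{R}^n$ be a function in $\mathrm{span}(\Phi_{\rm abs})$ (with a fixed evaluation procedure) that is metrically regular at $x^*\in\mathbb{R}^n$. Then the tangent mode piecewise linearization $\lozenge_{x^*}F$ is open in some neighborhood of $x^*$.
   Context: Elemental functions and PCS functions: $\Phi$ is a library of elemental functions consisting of the binary arithmetic operations and unary functions (such as $\sin,\cos,\exp,\log,\dots$), each differentiable with (locally) Lipschitz continuous derivative on its open domain; $\Phi_{\rm abs}=\Phi\cup\{\mathrm{abs}\}$ with $\mathrm{abs}(x)=|x|$. A function $F$ belongs to $\mathrm{span}(\Phi_{\rm abs})$ (is piecewise composite smooth, PCS) if it is computed by an evaluation procedure: a finite sequence of intermediate values $v_i$, beginning with the components of $x$ and ending with the components of $F(x)$, in which each further $v_i$ is $v_j\pm v_k$, $v_j * v_k$, $\varphi_i(v_j)$ with $\varphi_i\in\Phi$ unary, or $\mathrm{abs}(v_j)$ for earlier values $v_j,v_k$ (division is written as multiplication by a reciprocal; constants are allowed). The procedure is assumed well defined near all reference points considered. Tangent mode piecewise linearization at $\mathring x$: let $\mathring v_i$ be the values of the procedure at $\mathring x$. Starting from $\Delta x=x-\mathring x$, set $\Delta v_i=\Delta v_j\pm\Delta v_k$ if $v_i=v_j\pm v_k$; $\Delta v_i=\mathring v_j\Delta v_k+\Delta v_j\mathring v_k$ if $v_i=v_j*v_k$; $\Delta v_i=\varphi_i'(\mathring v_j)\Delta v_j$ if $v_i=\varphi_i(v_j)$; $\Delta v_i=|\mathring v_j+\Delta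 v_j|-|\mathring v_j|$ if $v_i=|v_j|$. The resulting output increment is $\Delta F(\mathring x;\Delta x)$, and $\lozenge_{\mathring x}F(x)=F(\mathring x)+\Delta F(\mathring x;x-\mathring x)$, a continuous piecewise linear function of $x\in\mathbb{R}^n$. A locally Lipschitz continuous function $F:\mathbb{R}^n\to\mathbb{R}^m$ is metrically regular at $x^*$ if there exist a constant $c>0$ and neighborhoods $\mathcal{D}$ of $x^*$ and $\mathcal{V}$ of $F(x^* )$ such that $\operatorname{dist}(x,F^{-1}(y))\le c\|y-F(x)\|$ for all $x\in\mathcal{D}$, $y\in\mathcal{V}$ (with $\operatorname{dist}(x,\varnothing)=\infty$). A map $P$ is open in a neighborhood $U$ of $x^*$ ($U$ open) if $P$ maps every open subset of $U$ to an open set. *)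

theory Defs
  imports "HOL-Analysis.Analysis" "HOL-Library.Sublist"
begin

definition locally_lipschitz_on :: "'a::metric_space set \<Rightarrow> ('a \<Rightarrow> 'b::metric_space) \<Rightarrow> bool" where
  "locally_lipschitz_on S f \<longleftrightarrow> (\<forall>x\<in>S. \<exists>\<epsilon>>0. \<exists>L. L-lipschitz_on (ball x \<epsilon> \<inter> S) f)"

text \<open>
  A unary elemental function is a pair of a function and its open domain; the values of the
  (total) function outside the domain are irrelevant. The binary arithmetic operations, which
  belong to every library, are built into the instructions below, so that a library is represented
  by its set of unary functions; the reciprocal is a unary function with domain \<open>- {0}\<close>.
\<close>

type_synonym elemental = "(real \<Rightarrow> real) \<times> real set"

definition elemental_library :: "elemental set \<Rightarrow> bool" where
  "elemental_library \<Phi> \<longleftrightarrow> (\<forall>(\<phi>, D)\<in>\<Phi>.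
     open D \<and> (\<forall>v\<in>D. \<phi> field_differentiable at v) \<and> locally_lipschitz_on D (deriv \<phi>))"

text \<open>
  Evaluation procedures are straight-line programs. The natural numbers in an instruction are
  positions in the list of the values computed so far, which starts with the components of the
  argument and is extended by one value at its end in each step.
\<close>

datatype instr =
    Const real
  | Add nat nat
  | Sub nat nat
  | Mult nat nat
  | Unary elemental nat
  | Abs nat

primrec instr_ok :: "elemental set \<Rightarrow> nat \<Rightarrow> instr \<Rightarrow> bool" where
  "instr_ok \<Phi> l (Const c) \<longleftrightarrow> True"
| "instr_ok \<Phi> l (Add j k) \<longleftrightarrow> j < l \<and> k < l"
| "instr_ok \<Phi> l (Sub j k) \<longleftrightarrow> j < l \<and> k < l"
| "instr_ok \<Phi> l (Mult j k) \<longleftrightarrow> j < l \<and> k < l"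
| "instr_ok \<Phi> l (Unary f j) \<longleftrightarrow> f \<in> \<Phi> \<and> j < l"
| "instr_ok \<Phi> l (Abs j) \<longleftrightarrow> j < l"

primrec instr_defined :: "instr \<Rightarrow> real list \<Rightarrow> bool" where
  "instr_defined (Const c) vs \<longleftrightarrow> True"
| "instr_defined (Add j k) vs \<longleftrightarrow> True"
| "instr_defined (Sub j k) vs \<longleftrightarrow> True"
| "instr_defined (Mult j k) vs \<longleftrightarrow> True"
| "instr_defined (Unary f j) vs \<longleftrightarrow> vs ! j \<in> snd f"
| "instr_defined (Abs j) vs \<longleftrightarrow> True"

primrec instr_value :: "instr \<Rightarrow> real list \<Rightarrow> real" where
  "instr_value (Const c) vs = c"
| "instr_value (Add j k) vs = vs ! j + vs ! k"
| "instr_value (Sub j k) vs = vs ! j - vs ! k"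
| "instr_value (Mult j k) vs = vs ! j * vs ! k"
| "instr_value (Unary f j) vs = fst f (vs ! j)"
| "instr_value (Abs j) vs = \<bar>vs ! j\<bar>"

text \<open>
  Tangent mode increments: \<open>vs\<close> are the values at the reference point, \<open>ds\<close> their increments.
\<close>

primrec instr_increment :: "instr \<Rightarrow> real list \<Rightarrow> real list \<Rightarrow> real" where
  "instr_increment (Const c) vs ds = 0"
| "instr_increment (Add j k) vs ds = ds ! j + ds ! k"
| "instr_increment (Sub j k) vs ds = ds ! j - ds ! k"
| "instr_increment (Mult j k) vs ds = vs ! j * ds ! k + ds ! j * vs ! k"
| "instr_increment (Unary f j) vs ds = deriv (fst f) (vs ! j) * ds ! j"
| "instr_increment (Abs j) vs ds = \<bar>vs ! j + ds ! j\<bar> - \<bar>vs ! j\<bar>"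

primrec proc_ok :: "elemental set \<Rightarrow> nat \<Rightarrow> instr list \<Rightarrow> bool" where
  "proc_ok \<Phi> l [] \<longleftrightarrow> True"
| "proc_ok \<Phi> l (i # p) \<longleftrightarrow> instr_ok \<Phi> l i \<and> proc_ok \<Phi> (Suc l) p"

primrec proc_defined :: "instr list \<Rightarrow> real list \<Rightarrow> bool" where
  "proc_defined [] vs \<longleftrightarrow> True"
| "proc_defined (i # p) vs \<longleftrightarrow> instr_defined i vs \<and> proc_defined p (vs @ [instr_value i vs])"

primrec proc_values :: "instr list \<Rightarrow> real list \<Rightarrow> real list" where
  "proc_values [] vs = vs"
| "proc_values (i # p) vs = proc_values p (vs @ [instr_value i vs])"

primrec proc_increments :: "instr list \<Rightarrow> real list \<Rightarrow> real list \<Rightarrow> real list" where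
  "proc_increments [] vs ds = ds"
| "proc_increments (i # p) vs ds =
     proc_increments p (vs @ [instr_value i vs]) (ds @ [instr_increment i vs ds])"

text \<open>
  Vectors are indexed by an arbitrary finite type, so the order in which their components occur in
  the list of values has to be fixed by a numbering of the index type.
\<close>

definition numbering :: "'n::finite list \<Rightarrow> bool" where
  "numbering ns \<longleftrightarrow> distinct ns \<and> set ns = UNIV"

definition components :: "'n::finite list \<Rightarrow> real ^ 'n \<Rightarrow> real list" where
  "components ns x = map (\<lambda>i. x $ i) ns"

text \<open>The vector whose components are the last entries of a list.\<close>

definition final_vector :: "'m::finite list \<Rightarrow> real list \<Rightarrow> real ^ 'm" where
  "final_vector ms vs = (\<chi> i. the (map_of (zip ms (drop (length vs - length ms) vs)) i))"

text \<open>
  The function \<open>F\<close> belongs to the span of the library together with \<open>abs\<close>, with evaluation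
  procedure \<open>p\<close>, near the point \<open>x\<^sub>0\<close>. The procedure need only be well defined near \<open>x\<^sub>0\<close>.
\<close>

definition evaluation_procedure_near ::
  "elemental set \<Rightarrow> 'n::finite list \<Rightarrow> 'm::finite list \<Rightarrow> instr list
     \<Rightarrow> (real ^ 'n \<Rightarrow> real ^ 'm) \<Rightarrow> real ^ 'n \<Rightarrow> bool" where
  "evaluation_procedure_near \<Phi> ns ms p F x\<^sub>0 \<longleftrightarrow>
     proc_ok \<Phi> (length ns) p \<and>
     (\<exists>U. open U \<and> x\<^sub>0 \<in> U \<and>
        (\<forall>x\<in>U. proc_defined p (components ns x) \<and>
               suffix (components ms (F x)) (proc_values p (components ns x))))"

definition tangent_increment ::
  "'n::finite list \<Rightarrow> 'm::finite list \<Rightarrow> instr list \<Rightarrow> real ^ 'n \<Rightarrow> real ^ 'n \<Rightarrow> real ^ 'm" where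
  "tangent_increment ns ms p x\<^sub>0 dx =
     final_vector ms (proc_increments p (components ns x\<^sub>0) (components ns dx))"

definition tangent_linearization ::
  "'n::finite list \<Rightarrow> 'm::finite list \<Rightarrow> instr list \<Rightarrow> (real ^ 'n \<Rightarrow> real ^ 'm)
     \<Rightarrow> real ^ 'n \<Rightarrow> real ^ 'n \<Rightarrow> real ^ 'm" where
  "tangent_linearization ns ms p F x\<^sub>0 x = F x\<^sub>0 + tangent_increment ns ms p x\<^sub>0 (x - x\<^sub>0)"

text \<open>
  Unlike \<^const>\<open>infdist\<close>, which is 0 for the empty set, the distance to the empty set is infinite.
\<close>

definition set_distance :: "'a::metric_space \<Rightarrow> 'a set \<Rightarrow> ereal" where
  "set_distance x A = (INF a\<in>A. ereal (dist x a))"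

text \<open>
  Metric regularity at a point is a local property, so local Lipschitz continuity is only
  required near that point.
\<close>

definition metrically_regular_at :: "(real ^ 'n \<Rightarrow> real ^ 'm) \<Rightarrow> real ^ 'n \<Rightarrow> bool" where
  "metrically_regular_at F x\<^sub>0 \<longleftrightarrow>
     (\<exists>U. open U \<and> x\<^sub>0 \<in> U \<and> locally_lipschitz_on U F) \<and>
     (\<exists>c>0. \<exists>D V. open D \<and> x\<^sub>0 \<in> D \<and> open V \<and> F x\<^sub>0 \<in> V \<and>
        (\<forall>x\<in>D. \<forall>y\<in>V. set_distance x (F -` {y}) \<le> ereal (c * norm (y - F x))))"

definition open_map_within ::
  "('a::topological_space \<Rightarrow> 'b::topological_space) \<Rightarrow> 'a set \<Rightarrow> bool" where
  "open_map_within P U \<longleftrightarrow> (\<forall>W. open W \<and> W \<subseteq> U \<longrightarrow> open (P ` W))"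

end

theory Submission
  imports Defs
begin

text \<open>
  Near \<open>x\<^sub>0\<close> the increment \<open>d h\<close> of the tangent linearization is positively homogeneous, Lipschitz
  continuous, and approximates \<open>F (x\<^sub>0 + h) - F x\<^sub>0\<close> up to \<open>o(norm h)\<close>. Hence the rescaled functions
  \<open>\<lambda>h. (F (x\<^sub>0 + t h) - F x\<^sub>0) / t\<close>, which are metrically regular with a constant independent of
  \<open>t\<close>, converge to \<open>d\<close> as \<open>t\<close> tends to 0. By compactness of closed balls this estimate passes to
  the limit: a point \<open>y\<close> close to \<open>d h\<close> has a preimage under \<open>d\<close> at a distance from \<open>h\<close> of order
  \<open>norm (y - d h)\<close>.
\<close>

section \<open>First-order expansions at 0 whose increments are homogeneous only near 0\<close>

lemma eventually_nhds_zero: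
  fixes P :: "'a::real_normed_vector \<Rightarrow> bool"
  shows "eventually P (nhds 0) \<longleftrightarrow> (\<exists>r>0. \<forall>h. norm h < r \<longrightarrow> P h)"
  by (simp add: eventually_nhds_metric)

lemma eventually_norm_less:
  "r > 0 \<Longrightarrow> \<forall>\<^sub>F h::'a::real_normed_vector in nhds 0. norm h < r"
  unfolding eventually_nhds_zero by blast

text \<open>The increment \<open>d\<close> acts as a directional derivative of \<open>f\<close> at
  0. Homogeneity is local, with factors at most 1, because the increment of an absolute value at a
  nonzero reference value has a kink away from 0.\<close>

definition conical_expansion ::
  "('a::real_normed_vector \<Rightarrow> 'b::real_normed_vector) \<Rightarrow> ('a \<Rightarrow> 'b) \<Rightarrow> bool" where
  "conical_expansion f d \<longleftrightarrow>
     (\<exists>L. L-lipschitz_on UNIV d) \<and>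
     (\<forall>\<^sub>F h in nhds 0. \<forall>t\<in>{0..1}. d (t *\<^sub>R h) = t *\<^sub>R d h) \<and>
     (\<forall>e>0. \<forall>\<^sub>F h in nhds 0. norm (f h - f 0 - d h) \<le> e * norm h)"

lemma conical_expansionI:
  assumes "L-lipschitz_on UNIV d"
    and "\<forall>\<^sub>F h in nhds 0. \<forall>t\<in>{0..1}. d (t *\<^sub>R h) = t *\<^sub>R d h"
    and "\<And>e. e > 0 \<Longrightarrow> \<forall>\<^sub>F h in nhds 0. norm (f h - f 0 - d h) \<le> e * norm h"
  shows "conical_expansion f d"
  using assms unfolding conical_expansion_def by blast

lemma conical_expansion_lipschitz:
  assumes "conical_expansion f d"
  obtains L where "L-lipschitz_on UNIV d"
  using assms unfolding conical_expansion_def by blast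

lemma conical_expansion_homogeneous:
  assumes "conical_expansion f d"
  shows "\<forall>\<^sub>F h in nhds 0. \<forall>t\<in>{0..1}. d (t *\<^sub>R h) = t *\<^sub>R d h"
  using assms unfolding conical_expansion_def by blast

lemma conical_expansion_error:
  assumes "conical_expansion f d" "e > 0"
  shows "\<forall>\<^sub>F h in nhds 0. norm (f h - f 0 - d h) \<le> e * norm h"
  using assms unfolding conical_expansion_def by blast

lemma conical_expansion_zero:
  assumes "conical_expansion f d"
  shows "d 0 = 0"
proof -
  have "\<forall>t\<in>{0..1}. d (t *\<^sub>R 0) = t *\<^sub>R d 0"
    using conical_expansion_homogeneous[OF assms] by (rule eventually_nhds_x_imp_x)
  from bspec[OF this, of 0] show ?thesis by simp
qed

lemma conical_expansion_norm_le:
  assumes "conical_expansion f d"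
  obtains L where "L > 0" "\<And>h. norm (d h) \<le> L * norm h"
    "\<forall>\<^sub>F h in nhds 0. norm (f h - f 0) \<le> L * norm h"
proof -
  obtain M where M: "M-lipschitz_on UNIV d"
    using assms by (rule conical_expansion_lipschitz)
  have "M \<ge> 0" using M by (rule lipschitz_on_nonneg)
  have d: "norm (d h) \<le> M * norm h" for h
    using lipschitz_onD[OF M, of h 0] conical_expansion_zero[OF assms] by (simp add: dist_norm)
  show thesis
  \<comment> \<open>The added 1 pays for the error with tolerance 1 and makes the constant positive
    even if \<open>M\<close> is 0.\<close>
  proof (rule that[of "M + 1"])
    show "norm (d h) \<le> (M + 1) * norm h" for h
      using d[of h] by (simp add: distrib_right add_increasing2)
    have "\<forall>\<^sub>F h in nhds 0. norm (f h - f 0 - d h) \<le> 1 * norm h"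
      by (rule conical_expansion_error[OF assms]) simp
    then show "\<forall>\<^sub>F h in nhds 0. norm (f h - f 0) \<le> (M + 1) * norm h"
    proof eventually_elim
      case (elim h)
      then show ?case
        using d[of h] norm_triangle_sub[of "f h - f 0" "d h"] by (simp add: distrib_right)
    qed
  qed (use \<open>M \<ge> 0\<close> in simp)
qed

text \<open>Needed because an evaluation procedure computes \<open>F\<close> only near the reference
  point.\<close>

lemma conical_expansion_cong:
  assumes "conical_expansion f d" "\<forall>\<^sub>F h in nhds 0. f h = g h"
  shows "conical_expansion g d"
proof -
  obtain L where L: "L-lipschitz_on UNIV d"
    using assms(1) by (rule conical_expansion_lipschitz)
  have "f 0 = g 0"
    using assms(2) by (rule eventually_nhds_x_imp_x)
  show ?thesis
  proof (rule conical_expansionI[OF L conical_expansion_homogeneous[OF assms(1)]])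
    fix e :: real assume "e > 0"
    from conical_expansion_error[OF assms(1) this] assms(2)
    show "\<forall>\<^sub>F h in nhds 0. norm (g h - g 0 - d h) \<le> e * norm h"
      by eventually_elim (use \<open>f 0 = g 0\<close> in simp)
  qed
qed

section \<open>Calculus rules for expansions\<close>

lemma conical_expansion_const: "conical_expansion (\<lambda>_. c) (\<lambda>_. 0)"
  by (rule conical_expansionI[of 0]) (auto intro: lipschitz_on_constant)

lemma conical_expansion_add:
  assumes "conical_expansion f d" "conical_expansion g e"
  shows "conical_expansion (\<lambda>h. f h + g h) (\<lambda>h. d h + e h)"
proof -
  obtain L M where LM: "L-lipschitz_on UNIV d" "M-lipschitz_on UNIV e"
    using assms conical_expansion_lipschitz by metis
  show ?thesis
  proof (rule conical_expansionI[OF lipschitz_on_add[OF LM]])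
    show "\<forall>\<^sub>F h in nhds 0. \<forall>t\<in>{0..1}.
        d (t *\<^sub>R h) + e (t *\<^sub>R h) = t *\<^sub>R (d h + e h)"
      using assms[THEN conical_expansion_homogeneous]
      by eventually_elim (simp add: scaleR_add_right)
  next
    fix \<epsilon> :: real assume "\<epsilon> > 0"
    then have "\<epsilon> / 2 > 0" by simp
    from conical_expansion_error[OF assms(1) this] conical_expansion_error[OF assms(2) this]
    show "\<forall>\<^sub>F h in nhds 0. norm (f h + g h - (f 0 + g 0) - (d h + e h)) \<le> \<epsilon> * norm h"
    proof eventually_elim
      case (elim h)
      have "f h + g h - (f 0 + g 0) - (d h + e h) = (f h - f 0 - d h) + (g h - g 0 - e h)"
        by simp
      also have "norm \<dots> \<le> \<epsilon> / 2 * norm h + \<epsilon> / 2 * norm h"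
        using elim by (rule norm_add_rule_thm)
      finally show ?case by (simp add: field_simps)
    qed
  qed
qed

text \<open>A bound \<open>K\<close> for \<open>T\<close> multiplies both the Lipschitz constant and
  the error. The rule covers negation, scaling and passing to or from components.\<close>

lemma conical_expansion_linear_compose:
  assumes "conical_expansion f d" "bounded_linear T"
  shows "conical_expansion (\<lambda>h. T (f h)) (\<lambda>h. T (d h))"
proof -
  interpret T: bounded_linear T by fact
  obtain L where L: "L-lipschitz_on UNIV d"
    using assms(1) by (rule conical_expansion_lipschitz)
  obtain K where K: "K > 0" "\<And>x. norm (T x) \<le> norm x * K"
    using T.pos_bounded by blast
  have "(K * L)-lipschitz_on UNIV (\<lambda>h. T (d h))"
  proof (rule lipschitz_onI)
    fix x y
    have "dist (T (d x)) (T (d y)) \<le> dist (d x) (d y) * K"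
      using K(2)[of "d x - d y"] by (simp add: dist_norm T.diff)
    also have "\<dots> \<le> L * dist x y * K"
      using lipschitz_onD[OF L, of x y] K(1) by (intro mult_right_mono) auto
    finally show "dist (T (d x)) (T (d y)) \<le> K * L * dist x y" by (simp add: ac_simps)
  qed (use K(1) lipschitz_on_nonneg[OF L] in simp)
  then show ?thesis
  proof (rule conical_expansionI)
    show "\<forall>\<^sub>F h in nhds 0. \<forall>t\<in>{0..1}. T (d (t *\<^sub>R h)) = t *\<^sub>R T (d h)"
      using conical_expansion_homogeneous[OF assms(1)] by eventually_elim (simp add: T.scaleR)
  next
    fix e :: real assume "e > 0"
    then have "e / K > 0" using K(1) by simp
    from conical_expansion_error[OF assms(1) this]
    show "\<forall>\<^sub>F h in nhds 0. norm (T (f h) - T (f 0) - T (d h)) \<le> e * norm h"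
    proof eventually_elim
      case (elim h)
      have "norm (T (f h) - T (f 0) - T (d h)) \<le> norm (f h - f 0 - d h) * K"
        using K(2) by (simp flip: T.diff)
      also have "\<dots> \<le> e / K * norm h * K"
        using elim K(1) by (intro mult_right_mono) auto
      finally show ?case using K(1) by simp
    qed
  qed
qed

lemma conical_expansion_diff:
  assumes "conical_expansion f d" "conical_expansion g e"
  shows "conical_expansion (\<lambda>h. f h - g h) (\<lambda>h. d h - e h)"
  using conical_expansion_add[OF assms(1) conical_expansion_linear_compose[OF assms(2)
    bounded_linear_minus[OF bounded_linear_ident]]] by simp

lemma conical_expansion_translation: "conical_expansion (\<lambda>h. x + h) (\<lambda>h. h)"
  by (rule conical_expansionI[of 1]) (auto intro: lipschitz_on_id)

lemma conical_expansion_sum: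
  assumes "\<And>i. i \<in> A \<Longrightarrow> conical_expansion (f i) (d i)"
  shows "conical_expansion (\<lambda>h. \<Sum>i\<in>A. f i h) (\<lambda>h. \<Sum>i\<in>A. d i h)"
  using assms
  by (induction A rule: infinite_finite_induct)
     (auto intro: conical_expansion_const conical_expansion_add)

text \<open>A vector is the sum of its components times the basis vectors, so the sum and linear
  rules suffice.\<close>

lemma conical_expansion_componentwise:
  fixes f d :: "'a::real_normed_vector \<Rightarrow> real ^ 'n"
  assumes "\<And>i. conical_expansion (\<lambda>h. f h $ i) (\<lambda>h. d h $ i)"
  shows "conical_expansion f d"
proof -
  have eq: "v = (\<Sum>i\<in>UNIV. (v $ i) *\<^sub>R axis i 1)" for v :: "real ^ 'n"
    by (simp add: basis_expansion flip: scalar_mult_eq_scaleR)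
  have "conical_expansion (\<lambda>h. \<Sum>i\<in>UNIV. (f h $ i) *\<^sub>R axis i 1)
      (\<lambda>h. \<Sum>i\<in>UNIV. (d h $ i) *\<^sub>R (axis i 1 :: real ^ 'n))"
    by (intro conical_expansion_sum conical_expansion_linear_compose[OF assms]
        bounded_linear_scaleR_left)
  then show ?thesis by (simp flip: eq)
qed

text \<open>Write \<open>f h * g h\<close> as \<open>f 0 * g h + f h * g 0 + (f h - f 0) * (g h - g
  0) - f 0 * g 0\<close>. The first two terms are linear in \<open>g\<close> and \<open>f\<close>;
  the product of differences is quadratic in \<open>norm h\<close> and contributes the increment
  0.\<close>

lemma conical_expansion_product:
  fixes f d g e :: "'a::real_normed_vector \<Rightarrow> real"
  assumes "conical_expansion f d" "conical_expansion g e"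
  shows "conical_expansion (\<lambda>h. f h * g h) (\<lambda>h. f 0 * e h + d h * g 0)"
proof -
  have lin: "conical_expansion (\<lambda>h. f 0 * g h + f h * g 0) (\<lambda>h. f 0 * e h + d h * g 0)"
    by (intro conical_expansion_add conical_expansion_linear_compose[OF assms(1)]
        conical_expansion_linear_compose[OF assms(2)] bounded_linear_intros)
  obtain K where K: "K > 0" "\<forall>\<^sub>F h in nhds 0. norm (f h - f 0) \<le> K * norm h"
    using assms(1) by (rule conical_expansion_norm_le)
  obtain L where L: "L > 0" "\<forall>\<^sub>F h in nhds 0. norm (g h - g 0) \<le> L * norm h"
    using assms(2) by (rule conical_expansion_norm_le)
  have prod: "conical_expansion (\<lambda>h. (f h - f 0) * (g h - g 0)) (\<lambda>_. 0)"
  proof (rule conical_expansionI[of 0])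
    fix r :: real assume "r > 0"
    then have "r / (K * L) > 0" using K L by simp
    from eventually_norm_less[OF this] K(2) L(2)
    show "\<forall>\<^sub>F h in nhds 0.
        norm ((f h - f 0) * (g h - g 0) - (f 0 - f 0) * (g 0 - g 0) - 0) \<le> r * norm h"
    proof eventually_elim
      case (elim h)
      have "norm ((f h - f 0) * (g h - g 0)) \<le> (K * norm h) * (L * norm h)"
        unfolding norm_mult using elim K(1) by (intro mult_mono) auto
      also have "\<dots> = (norm h * (K * L)) * norm h" by simp
      also have "\<dots> \<le> r * norm h"
        using elim(1) K(1) L(1) by (intro mult_right_mono) (simp_all add: pos_less_divide_eq)
      finally show ?case by simp
    qed
  qed (auto intro: lipschitz_on_constant)
  have "conical_expansion (\<lambda>h. (f 0 * g h + f h * g 0) + (f h - f 0) * (g h - g 0) - f 0 * g 0)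
      (\<lambda>h. f 0 * e h + d h * g 0)"
    using conical_expansion_diff[OF conical_expansion_add[OF lin prod] conical_expansion_const]
    by simp
  then show ?thesis
    by (rule conical_expansion_cong) (simp add: algebra_simps)
qed

text \<open>Split off the linear part \<open>\<phi>' * f h\<close>. The remainder \<open>R\<close>
  has increment 0, since differentiability makes it small relative to \<open>f h - f 0\<close>,
  which is itself at most \<open>K * norm h\<close>.\<close>

lemma conical_expansion_differentiable_compose:
  fixes f d :: "'a::real_normed_vector \<Rightarrow> real"
  assumes "conical_expansion f d" "(\<phi> has_field_derivative \<phi>') (at (f 0))"
  shows "conical_expansion (\<lambda>h. \<phi> (f h)) (\<lambda>h. \<phi>' * d h)"
proof -
  have lin: "conical_expansion (\<lambda>h. \<phi>' * f h) (\<lambda>h. \<phi>' * d h)"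
    by (intro conical_expansion_linear_compose[OF assms(1)] bounded_linear_intros)
  obtain K where K: "K > 0" "\<forall>\<^sub>F h in nhds 0. norm (f h - f 0) \<le> K * norm h"
    using assms(1) by (rule conical_expansion_norm_le)
  define R where "R h = \<phi> (f h) - \<phi>' * f h" for h
  have "conical_expansion R (\<lambda>_. 0)"
  proof (rule conical_expansionI[of 0])
    fix r :: real assume "r > 0"
    then have "r / K > 0" using K by simp
    then obtain \<delta> where \<delta>: "\<delta> > 0"
      "\<And>y. norm (y - f 0) < \<delta> \<Longrightarrow>
         norm (\<phi> y - \<phi> (f 0) - \<phi>' * (y - f 0)) \<le> r / K * norm (y - f 0)"
      using assms(2)[THEN has_field_derivative_imp_has_derivative]
      unfolding has_derivative_at_alt by blast
    have "\<delta> / K > 0" using \<delta> K by simp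
    from K(2) eventually_norm_less[OF this] show "\<forall>\<^sub>F h in nhds 0. norm (R h - R 0 - 0) \<le> r * norm h"
    proof eventually_elim
      case (elim h)
      have "norm (f h - f 0) \<le> K * norm h" by fact
      also have "\<dots> < \<delta>"
        using elim(2) K(1) by (simp add: pos_less_divide_eq mult.commute)
      finally have "norm (\<phi> (f h) - \<phi> (f 0) - \<phi>' * (f h - f 0)) \<le> r / K * norm (f h - f 0)"
        by (rule \<delta>(2))
      also have "\<dots> \<le> r / K * (K * norm h)"
        using elim(1) \<open>r / K > 0\<close> by (intro mult_left_mono) auto
      finally show ?case
        using K(1) by (simp add: R_def algebra_simps)
    qed
  qed (auto intro: lipschitz_on_constant)
  from conical_expansion_add[OF this lin] show ?thesis by (simp add: R_def)
qed

text \<open>The absolute value is 1-Lipschitz, so it preserves the Lipschitz constant and the error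
  bound. For homogeneity, if \<open>f 0\<close> is 0 the increment is the absolute value of
  \<open>d h\<close>; otherwise \<open>f 0 + d h\<close> does not change sign for small
  \<open>h\<close>, and the increment is \<open>d h\<close> up to sign.\<close>

lemma conical_expansion_abs:
  fixes f d :: "'a::real_normed_vector \<Rightarrow> real"
  assumes "conical_expansion f d"
  shows "conical_expansion (\<lambda>h. \<bar>f h\<bar>) (\<lambda>h. \<bar>f 0 + d h\<bar> - \<bar>f 0\<bar>)"
proof -
  obtain M where M: "M-lipschitz_on UNIV d"
    using assms by (rule conical_expansion_lipschitz)
  have "M-lipschitz_on UNIV (\<lambda>h. \<bar>f 0 + d h\<bar> - \<bar>f 0\<bar>)"
  proof (rule lipschitz_onI)
    fix x y
    show "dist (\<bar>f 0 + d x\<bar> - \<bar>f 0\<bar>) (\<bar>f 0 + d y\<bar> - \<bar>f 0\<bar>) \<le> M * dist x y"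
      using lipschitz_onD[OF M, of x y] by (simp add: dist_real_def)
  qed (rule lipschitz_on_nonneg[OF M])
  then show ?thesis
  proof (rule conical_expansionI)
    obtain L where L: "L > 0" "\<And>h. norm (d h) \<le> L * norm h"
      using conical_expansion_norm_le[OF assms] by blast
    have small: "\<forall>\<^sub>F h in nhds 0. f 0 \<noteq> 0 \<longrightarrow> \<bar>d h\<bar> \<le> \<bar>f 0\<bar>"
    proof (cases "f 0 = 0")
      case False
      then have "\<bar>f 0\<bar> / L > 0" using L(1) by simp
      then have "\<forall>\<^sub>F h::'a in nhds 0. norm h < \<bar>f 0\<bar> / L"
        by (rule eventually_norm_less)
      then show ?thesis
      proof eventually_elim
        case (elim h)
        then show ?case
          using L(2)[of h] L(1) by (simp add: pos_less_divide_eq mult.commute)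
      qed
    qed simp
    have scale: "\<bar>a + t * b\<bar> - \<bar>a\<bar> = t * (\<bar>a + b\<bar> - \<bar>a\<bar>)"
      if "a \<noteq> 0 \<longrightarrow> \<bar>b\<bar> \<le> \<bar>a\<bar>" "0 \<le> t" "t \<le> 1" for a b t :: real
    proof -
      have "\<bar>t * b\<bar> \<le> 1 * \<bar>b\<bar>"
        unfolding abs_mult using that by (intro mult_right_mono) auto
      moreover have "\<bar>t * b\<bar> = t * \<bar>b\<bar>"
        using that by (simp add: abs_mult)
      ultimately show ?thesis
        using that(1) by (cases a "0::real" rule: linorder_cases) (auto simp: algebra_simps)
    qed
    from conical_expansion_homogeneous[OF assms] small
    show "\<forall>\<^sub>F h in nhds 0. \<forall>t\<in>{0..1}.
        \<bar>f 0 + d (t *\<^sub>R h)\<bar> - \<bar>f 0\<bar> = t *\<^sub>R (\<bar>f 0 + d h\<bar> - \<bar>f 0\<bar>)"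
      by eventually_elim (simp add: scale)
  next
    fix e :: real assume "e > 0"
    from conical_expansion_error[OF assms this]
    show "\<forall>\<^sub>F h in nhds 0. norm (\<bar>f h\<bar> - \<bar>f 0\<bar> - (\<bar>f 0 + d h\<bar> - \<bar>f 0\<bar>)) \<le> e * norm h"
      by eventually_elim (simp add: abs_if split: if_splits)
  qed
qed

section \<open>Expansion of evaluation procedures\<close>

text \<open>Each kind of instruction is matched by one calculus rule; \<open>vs 0\<close> holds the
  values at the reference point.\<close>

lemma conical_expansion_instr:
  assumes "elemental_library \<Phi>" "instr_ok \<Phi> l i" "instr_defined i (vs 0)"
    and "\<And>j. j < l \<Longrightarrow> conical_expansion (\<lambda>h. vs h ! j) (\<lambda>h. ds h ! j)"
  shows "conical_expansion (\<lambda>h. instr_value i (vs h)) (\<lambda>h. instr_increment i (vs 0) (ds h))"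
proof (cases i)
  case (Const c)
  then show ?thesis by (simp add: conical_expansion_const)
next
  case (Add j k)
  with assms(2) show ?thesis by (simp add: conical_expansion_add assms(4))
next
  case (Sub j k)
  with assms(2) show ?thesis by (simp add: conical_expansion_diff assms(4))
next
  case (Mult j k)
  with assms(2) show ?thesis
    using conical_expansion_product[OF assms(4)[of j] assms(4)[of k]] by simp
next
  case (Unary f j)
  then have "f \<in> \<Phi>" "vs 0 ! j \<in> snd f" "j < l" using assms(2,3) by auto
  then have "fst f field_differentiable at (vs 0 ! j)"
    using assms(1) unfolding elemental_library_def by (cases f) auto
  then have "(fst f has_field_derivative deriv (fst f) (vs 0 ! j)) (at (vs 0 ! j))"
    by (simp add: field_differentiable_derivI)
  from conical_expansion_differentiable_compose[OF assms(4)[OF \<open>j < l\<close>] this]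
  show ?thesis unfolding Unary by simp
next
  case (Abs j)
  with assms(2) show ?thesis
    using conical_expansion_abs[OF assms(4)[of j]] by simp
qed

lemma length_proc_values: "length (proc_values p vs) = length vs + length p"
  by (induction p arbitrary: vs) auto

lemma length_proc_increments: "length (proc_increments p vs ds) = length ds + length p"
  by (induction p arbitrary: vs ds) auto

text \<open>Induction along the program, with the lists of values and increments generalized to
  arbitrary functions of \<open>h\<close>. The invariant is that every entry computed so far has an
  expansion.\<close>

lemma conical_expansion_proc:
  assumes "elemental_library \<Phi>" "proc_ok \<Phi> l p" "proc_defined p (vs 0)"
    and "\<And>h. length (vs h) = l" "\<And>h. length (ds h) = l"
    and "\<And>j. j < l \<Longrightarrow> conical_expansion (\<lambda>h. vs h ! j) (\<lambda>h. ds h ! j)"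
    and "j < l + length p"
  shows "conical_expansion (\<lambda>h. proc_values p (vs h) ! j)
           (\<lambda>h. proc_increments p (vs 0) (ds h) ! j)"
  using assms(2-)
proof (induction p arbitrary: l vs ds)
  case Nil
  then show ?case by simp
next
  case (Cons i p)
  let ?vs = "\<lambda>h. vs h @ [instr_value i (vs h)]"
  let ?ds = "\<lambda>h. ds h @ [instr_increment i (vs 0) (ds h)]"
  have "conical_expansion (\<lambda>h. instr_value i (vs h)) (\<lambda>h. instr_increment i (vs 0) (ds h))"
    using Cons.prems by (intro conical_expansion_instr[OF assms(1), where l = l]) auto
  \<comment> \<open>Position \<open>l\<close> is the entry just appended; the earlier positions are
    unchanged.\<close>
  then have step: "conical_expansion (\<lambda>h. ?vs h ! k) (\<lambda>h. ?ds h ! k)" if "k < Suc l" for k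
    using that Cons.prems(3-5) by (cases "k = l") (simp_all add: nth_append)
  have "conical_expansion (\<lambda>h. proc_values p (?vs h) ! j)
      (\<lambda>h. proc_increments p (?vs 0) (?ds h) ! j)"
    using Cons.prems step by (intro Cons.IH[where l = "Suc l"]) auto
  then show ?case by simp
qed

lemma final_vector_nth:
  assumes "numbering ns" "k < length ns" "length ns \<le> length vs"
  shows "final_vector ns vs $ (ns ! k) = vs ! (length vs - length ns + k)"
  using assms by (simp add: final_vector_def numbering_def map_of_zip_nth)

text \<open>Recovers \<open>F x\<close> as a function of the computed list from the relational
  suffix condition, so that expansions of entries carry over to \<open>F\<close>.\<close>

lemma final_vector_suffix:
  fixes x :: "real ^ 'n"
  assumes "numbering ns" "suffix (components ns x) vs"
  shows "final_vector ns vs = x"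
proof (rule vec_eq_iff[THEN iffD2], rule allI)
  fix i
  obtain k where k: "k < length ns" "i = ns ! k"
    using assms(1) by (metis UNIV_I in_set_conv_nth numbering_def)
  obtain us where us: "vs = us @ components ns x"
    using assms(2) by (auto simp: suffix_def)
  then have "length vs = length us + length ns" by (simp add: components_def)
  then show "final_vector ns vs $ i = x $ i"
    using final_vector_nth[OF assms(1) k(1), of vs] us k by (simp add: components_def nth_append)
qed

text \<open>The entries of the initial lists expand by translation, the program propagates this to
  all entries, and the last ones are the components of \<open>F\<close> near the reference
  point.\<close>

lemma conical_expansion_tangent_increment:
  fixes F :: "real ^ 'n \<Rightarrow> real ^ 'm"
  assumes "elemental_library \<Phi>" "numbering ms" "evaluation_procedure_near \<Phi> ns ms p F x\<^sub>0"
  shows "conical_expansion (\<lambda>h. F (x\<^sub>0 + h)) (tangent_increment ns ms p x\<^sub>0)"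
proof -
  obtain U where ok: "proc_ok \<Phi> (length ns) p" and U: "open U" "x\<^sub>0 \<in> U"
    "\<And>x. x \<in> U \<Longrightarrow> proc_defined p (components ns x)"
    "\<And>x. x \<in> U \<Longrightarrow> suffix (components ms (F x)) (proc_values p (components ns x))"
    using assms(3) unfolding evaluation_procedure_near_def by blast
  let ?vs = "\<lambda>h. proc_values p (components ns (x\<^sub>0 + h))"
  let ?ds = "\<lambda>h. proc_increments p (components ns x\<^sub>0) (components ns h)"
  have len: "length (components ns x) = length ns" for x :: "real ^ 'n"
    by (simp add: components_def)
  have coord: "conical_expansion (\<lambda>h. components ns (x\<^sub>0 + h) ! j) (\<lambda>h. components ns h ! j)"
    if "j < length ns" for j
  proof -
    have "conical_expansion (\<lambda>h. (x\<^sub>0 + h) $ (ns ! j)) (\<lambda>h. h $ (ns ! j))"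
      by (rule conical_expansion_linear_compose[OF conical_expansion_translation
            bounded_linear_vec_nth])
    with that show ?thesis by (simp add: components_def)
  qed
  have entry: "conical_expansion (\<lambda>h. ?vs h ! j) (\<lambda>h. ?ds h ! j)"
    if "j < length ns + length p" for j
    using conical_expansion_proc[OF assms(1) ok, of "\<lambda>h. components ns (x\<^sub>0 + h)" "components ns" j]
      U(2,3) len coord that by simp
  \<comment> \<open>Guards against truncated subtraction in the position at which the output
    components start.\<close>
  have le: "length ms \<le> length ns + length p"
    using suffix_length_le[OF U(4)[OF U(2)]] by (simp add: length_proc_values components_def)
  have "conical_expansion (\<lambda>h. final_vector ms (?vs h)) (\<lambda>h. final_vector ms (?ds h))"
  proof (rule conical_expansion_componentwise)
    fix i
    obtain k where "k < length ms" "i = ms ! k"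
      using assms(2) by (metis UNIV_I in_set_conv_nth numbering_def)
    then show "conical_expansion (\<lambda>h. final_vector ms (?vs h) $ i) (\<lambda>h. final_vector ms (?ds h) $ i)"
      using le entry[of "length ns + length p - length ms + k"]
      by (simp add: final_vector_nth[OF assms(2)] length_proc_values length_proc_increments len)
  qed
  moreover have "\<forall>\<^sub>F h in nhds 0. final_vector ms (?vs h) = F (x\<^sub>0 + h)"
  proof (rule eventually_mono)
    show "\<forall>\<^sub>F h in nhds 0. x\<^sub>0 + h \<in> U"
      using eventually_nhds_in_open[OF open_vimage[OF U(1), of "\<lambda>h. x\<^sub>0 + h"], of 0] U(2)
      by (simp add: continuous_intros)
  qed (rule final_vector_suffix[OF assms(2) U(4)])
  ultimately show ?thesis
    unfolding tangent_increment_def by (rule conical_expansion_cong)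
qed

section \<open>From metric regularity to openness of the increment\<close>

text \<open>A finite bound excludes an empty preimage, whose distance is infinite, and so yields an
  actual solution \<open>a\<close>; if \<open>y = F x\<close>, the point \<open>x\<close> itself
  serves.\<close>

lemma metrically_regular_at_solution:
  assumes "metrically_regular_at F x\<^sub>0"
  obtains c D V where "c > 0" "open D" "x\<^sub>0 \<in> D" "open V" "F x\<^sub>0 \<in> V"
    "\<And>x y. x \<in> D \<Longrightarrow> y \<in> V \<Longrightarrow> \<exists>a. F a = y \<and> norm (a - x) \<le> c * norm (y - F x)"
proof -
  obtain c D V where c: "c > 0" "open D" "x\<^sub>0 \<in> D" "open V" "F x\<^sub>0 \<in> V"
    and reg: "\<And>x y. x \<in> D \<Longrightarrow> y \<in> V \<Longrightarrow>
      set_distance x (F -` {y}) \<le> ereal (c * norm (y - F x))"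
    using assms unfolding metrically_regular_at_def by blast
  \<comment> \<open>The distance need not be attained, whence the factor 2.\<close>
  have "\<exists>a. F a = y \<and> norm (a - x) \<le> (2 * c) * norm (y - F x)" if xy: "x \<in> D" "y \<in> V" for x y
  proof (cases "y = F x")
    case False
    then have "c * norm (y - F x) < 2 * c * norm (y - F x)" using c(1) by simp
    then have "set_distance x (F -` {y}) < ereal (2 * c * norm (y - F x))"
      using reg[OF xy] by (simp add: order_le_less_trans)
    then obtain a where "F a = y" "ereal (dist x a) < ereal (2 * c * norm (y - F x))"
      unfolding set_distance_def INF_less_iff by blast
    then show ?thesis
      by (intro exI[of _ a]) (simp add: dist_norm norm_minus_commute)
  qed auto
  with c show thesis by (intro that[of "2 * c" D V]) auto
qed

text \<open>Openness follows from a covering property: if \<open>cball h \<delta>\<close> lies in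
  \<open>ball 0 r\<close>, its image under \<open>d\<close> contains the ball of radius
  \<open>\<delta> / c\<close> around \<open>d h\<close>.\<close>

lemma conical_expansion_open:
  fixes f d :: "'a::euclidean_space \<Rightarrow> 'b::euclidean_space"
  assumes exp: "conical_expansion f d"
    and "c > 0" "open D" "0 \<in> D" "open V" "f 0 \<in> V"
    and solution: "\<And>x y. x \<in> D \<Longrightarrow> y \<in> V \<Longrightarrow> \<exists>a. f a = y \<and> norm (a - x) \<le> c * norm (y - f x)"
  obtains r where "r > 0" "open_map_within d (ball 0 r)"
proof -
  obtain r where r: "r > 0"
    and hom: "\<And>h t. norm h < r \<Longrightarrow> 0 \<le> t \<Longrightarrow> t \<le> 1 \<Longrightarrow> d (t *\<^sub>R h) = t *\<^sub>R d h"
    using conical_expansion_homogeneous[OF exp] unfolding eventually_nhds_zero by auto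
  obtain \<delta>1 where \<delta>1: "\<delta>1 > 0" "ball 0 \<delta>1 \<subseteq> D"
    using assms(3,4) openE by blast
  obtain \<delta>2 where \<delta>2: "\<delta>2 > 0" "ball (f 0) \<delta>2 \<subseteq> V"
    using assms(5,6) openE by blast
  have cont: "continuous_on S d" for S
    using exp conical_expansion_lipschitz lipschitz_on_continuous_on lipschitz_on_subset
    by (metis subset_UNIV)
  have covers: "y \<in> d ` cball h \<delta>"
    if sub: "cball h \<delta> \<subseteq> ball 0 r" and "\<delta> > 0" and y: "c * norm (y - d h) < \<delta>" for h y \<delta>
  proof -
    have h: "norm h < r" using subsetD[OF sub, of h] \<open>\<delta> > 0\<close> by simp
    \<comment> \<open>Approximate preimages are enough, because the image of the compact ball is
      closed.\<close>
    have "\<exists>z\<in>d ` cball h \<delta>. dist z y < e" if "e > 0" for e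
    proof -
      \<comment> \<open>The relative error allowed for \<open>d\<close>: the first bound uses the
        slack in \<open>c * norm (y - d h) < \<delta>\<close> to keep the approximate preimage in
        \<open>cball h \<delta>\<close>, the second makes its residual less than
        \<open>e\<close>.\<close>
      define \<eta> where "\<eta> = min ((\<delta> - c * norm (y - d h)) / (c * r)) (e / (2 * r))"
      have \<eta>: "\<eta> > 0" "c * (\<eta> * r) \<le> \<delta> - c * norm (y - d h)" "\<eta> * r < e"
      proof -
        show "\<eta> > 0" using y r \<open>c > 0\<close> \<open>e > 0\<close> by (simp add: \<eta>_def)
        have "\<eta> \<le> (\<delta> - c * norm (y - d h)) / (c * r)" by (simp add: \<eta>_def)
        then show "c * (\<eta> * r) \<le> \<delta> - c * norm (y - d h)"
          using r \<open>c > 0\<close> by (simp add: pos_le_divide_eq ac_simps)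
        have "\<eta> \<le> e / (2 * r)" by (simp add: \<eta>_def)
        then have "\<eta> * r \<le> e / 2" using r by (simp add: field_simps)
        then show "\<eta> * r < e" using \<open>e > 0\<close> by simp
      qed
      obtain \<rho> where \<rho>: "\<rho> > 0"
        and err: "\<And>x. norm x < \<rho> \<Longrightarrow> norm (f x - f 0 - d x) \<le> \<eta> * norm x"
        using conical_expansion_error[OF exp \<eta>(1)] unfolding eventually_nhds_zero by auto
      \<comment> \<open>The scale at which \<open>f\<close> is used: \<open>t *\<^sub>R h\<close>
        must lie in \<open>D\<close>, \<open>f 0 + t *\<^sub>R y\<close> in \<open>V\<close>, and
        the scaled ball of radius \<open>r\<close> within the range \<open>\<rho>\<close> of the
        error estimate. Adding 1 to \<open>norm y\<close> avoids division by 0 and gives a strict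
        inequality.\<close>
      define t where "t = Min {1, \<rho> / r, \<delta>1 / r, \<delta>2 / (norm y + 1)}"
      have t: "0 < t" "t \<le> 1" "t * r \<le> \<rho>" "t * r \<le> \<delta>1" "t * (norm y + 1) \<le> \<delta>2"
      proof -
        have pos: "norm y + 1 > 0" by (simp add: add_nonneg_pos)
        show "0 < t" using \<rho> \<delta>1 \<delta>2 r pos by (simp add: t_def)
        show "t \<le> 1" by (simp add: t_def)
        have "t \<le> \<rho> / r" "t \<le> \<delta>1 / r" "t \<le> \<delta>2 / (norm y + 1)" by (simp_all add: t_def)
        then show "t * r \<le> \<rho>" "t * r \<le> \<delta>1" "t * (norm y + 1) \<le> \<delta>2"
          using r pos by (simp_all add: pos_le_divide_eq)
      qed
      have th: "norm (t *\<^sub>R x) < t * r" if "norm x < r" for x :: 'a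
        using that t(1) by simp
      have "t *\<^sub>R h \<in> D"
        using th[OF h] t(4) \<delta>1(2) by auto
      moreover have "norm (t *\<^sub>R y) < \<delta>2"
        using t(1,5) by (simp add: distrib_left)
      then have "f 0 + t *\<^sub>R y \<in> V"
        using \<delta>2(2) by (auto simp: dist_norm)
      ultimately obtain a where a: "f a = f 0 + t *\<^sub>R y"
        "norm (a - t *\<^sub>R h) \<le> c * norm (f 0 + t *\<^sub>R y - f (t *\<^sub>R h))"
        using solution by blast
      \<comment> \<open>Undoing the scaling of the exact solution \<open>a\<close> for
        \<open>f\<close> gives the approximate preimage of \<open>y\<close> under
        \<open>d\<close>.\<close>
      define k where "k = (1 / t) *\<^sub>R a"
      have a_eq: "a = t *\<^sub>R k" using t(1) by (simp add: k_def)
      have "norm (f 0 + t *\<^sub>R y - f (t *\<^sub>R h))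
          = norm (t *\<^sub>R (y - d h) - (f (t *\<^sub>R h) - f 0 - d (t *\<^sub>R h)))"
        using hom[OF h] t(1,2) by (simp add: scaleR_diff_right algebra_simps)
      also have "\<dots> \<le> norm (t *\<^sub>R (y - d h)) + norm (f (t *\<^sub>R h) - f 0 - d (t *\<^sub>R h))"
        by (rule norm_triangle_ineq4)
      also have "\<dots> \<le> norm (t *\<^sub>R (y - d h)) + \<eta> * (t * r)"
        using err[of "t *\<^sub>R h"] th[OF h] t(3) mult_left_mono[of "norm (t *\<^sub>R h)" "t * r" \<eta>] \<eta>(1)
        by linarith
      also have "\<dots> = t * (norm (y - d h) + \<eta> * r)"
        using t(1) by (simp add: distrib_left)
      finally have "c * norm (f 0 + t *\<^sub>R y - f (t *\<^sub>R h)) \<le> c * (t * (norm (y - d h) + \<eta> * r))"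
        using \<open>c > 0\<close> by (simp add: mult_left_mono)
      with a(2) have "norm (t *\<^sub>R (k - h)) \<le> t * (c * (norm (y - d h) + \<eta> * r))"
        by (simp add: a_eq scaleR_diff_right ac_simps)
      then have "norm (k - h) \<le> c * (norm (y - d h) + \<eta> * r)"
        using t(1) by simp
      also have "\<dots> \<le> \<delta>" using \<eta>(2) by (simp add: distrib_left)
      finally have k: "k \<in> cball h \<delta>"
        by (simp add: dist_norm norm_minus_commute)
      then have kr: "norm k < r" using sub by auto
      \<comment> \<open>As \<open>f a - f 0\<close> is exactly \<open>t *\<^sub>R y\<close>,
        homogeneity at \<open>k\<close> turns the residual into the expansion error at
        \<open>a\<close>.\<close>
      have "t *\<^sub>R (y - d k) = f a - f 0 - d a"
        using hom[OF kr] t(1,2) a(1) by (simp add: a_eq scaleR_diff_right)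
      then have "t * norm (y - d k) = norm (f a - f 0 - d a)"
        using t(1) by (metis abs_of_pos norm_scaleR)
      also have "\<dots> \<le> \<eta> * norm a"
        using err[of a] th[OF kr] t(3) by (simp add: a_eq)
      also have "\<dots> \<le> \<eta> * (t * r)"
        using th[OF kr] \<eta>(1) by (intro mult_left_mono) (simp_all add: a_eq)
      also have "\<dots> = t * (\<eta> * r)" by simp
      finally have "norm (y - d k) \<le> \<eta> * r" using t(1) by simp
      with \<eta>(3) k show ?thesis
        by (intro bexI[of _ "d k"]) (simp_all add: dist_norm norm_minus_commute)
    qed
    then have "y \<in> closure (d ` cball h \<delta>)"
      by (simp add: closure_approachable)
    moreover have "closed (d ` cball h \<delta>)"
      by (intro compact_imp_closed compact_continuous_image cont compact_cball)
    ultimately show ?thesis by simp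
  qed
  have "open_map_within d (ball 0 r)"
    unfolding open_map_within_def
  proof (intro allI impI)
    fix W :: "'a set" assume W: "open W \<and> W \<subseteq> ball 0 r"
    show "open (d ` W)"
    proof (rule openI)
      fix z assume "z \<in> d ` W"
      then obtain h where h: "h \<in> W" "z = d h" by blast
      then obtain \<delta> where \<delta>: "\<delta> > 0" "cball h \<delta> \<subseteq> W"
        using W open_contains_cball by blast
      have "ball z (\<delta> / c) \<subseteq> d ` W"
      proof
        fix y assume "y \<in> ball z (\<delta> / c)"
        then have "c * norm (y - d h) < \<delta>"
          using \<open>c > 0\<close> h(2) by (simp add: dist_norm norm_minus_commute pos_less_divide_eq mult.commute)
        then show "y \<in> d ` W"
          using covers[of h \<delta> y] \<delta> W by blast
      qed
      then show "\<exists>e>0. ball z e \<subseteq> d ` W"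
        using \<delta>(1) \<open>c > 0\<close> by (intro exI[of _ "\<delta> / c"]) simp
    qed
  qed
  with r show thesis by (rule that)
qed

section \<open>Transfer from increments at 0 to the tangent linearization at the reference
  point\<close>

theorem proposition3p10:
  fixes \<Phi> :: "elemental set"
    and ns :: "'n::finite list"
    and p :: "instr list"
    and F :: "real ^ 'n \<Rightarrow> real ^ 'n"
    and xstar :: "real ^ 'n"
  assumes "elemental_library \<Phi>"
    and "numbering ns"
    and "evaluation_procedure_near \<Phi> ns ns p F xstar"
    and "metrically_regular_at F xstar"
  shows "\<exists>U. open U \<and> xstar \<in> U \<and> open_map_within (tangent_linearization ns ns p F xstar) U"
proof -
  let ?f = "\<lambda>h. F (xstar + h)" and ?d = "tangent_increment ns ns p xstar"
  obtain c D V where c: "c > 0" "open D" "xstar \<in> D" "open V" "F xstar \<in> V"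
    and solution: "\<And>x y. x \<in> D \<Longrightarrow> y \<in> V \<Longrightarrow>
      \<exists>a. F a = y \<and> norm (a - x) \<le> c * norm (y - F x)"
    using metrically_regular_at_solution[OF assms(4)] by blast
  have "open ((\<lambda>h. xstar + h) -` D)"
    using c(2) by (intro open_vimage continuous_intros)
  moreover have "\<exists>a. ?f a = y \<and> norm (a - x) \<le> c * norm (y - ?f x)"
    if xy: "x \<in> (\<lambda>h. xstar + h) -` D" "y \<in> V" for x y
  proof -
    obtain a where "F a = y" "norm (a - (xstar + x)) \<le> c * norm (y - F (xstar + x))"
      using solution[of "xstar + x" y] xy by auto
    then show ?thesis by (intro exI[of _ "a - xstar"]) (simp add: algebra_simps)
  qed
  ultimately obtain r where r: "r > 0" "open_map_within ?d (ball 0 r)"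
    using c
    by (elim conical_expansion_open[OF conical_expansion_tangent_increment[OF assms(1-3)] c(1), rotated -1])
       auto
  \<comment> \<open>The linearization is the increment composed with translations on both sides, and
    these preserve open sets.\<close>
  have "open (tangent_linearization ns ns p F xstar ` W)" if "open W" "W \<subseteq> ball xstar r" for W
  proof -
    have "open ((\<lambda>x. x - xstar) ` W)"
      using that(1) by (rule open_translation_subtract)
    moreover have "(\<lambda>x. x - xstar) ` W \<subseteq> ball 0 r"
      using that(2) by (auto simp: dist_norm norm_minus_commute)
    ultimately have "open (?d ` (\<lambda>x. x - xstar) ` W)"
      using r(2) by (simp add: open_map_within_def)
    then have "open ((\<lambda>y. F xstar + y) ` ?d ` (\<lambda>x. x - xstar) ` W)"
      by (rule open_translation)
    then show ?thesis
      by (simp add: image_image tangent_linearization_def)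
  qed
  then show ?thesis
    using r(1) by (intro exI[of _ "ball xstar r"]) (simp add: open_map_within_def)
qed

end
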